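(* Let $N \geqslant 2$, and let $\{ n_i : i \geqslant 0 \} \subset \mathbb{Z}^{\geqslant 0} \cup [N-2,\infty)$ be a set of pairwise distinct real numbers (indexed by the integers $i \geqslant 0$). For each $i$, let $\epsilon_i \in \{-1,0,+1\}$ be a sign such that whenever $\epsilon_{i_0} = -1$, one has $\epsilon_i = +1$ for at least $N$ choices of $i$ satisfying $n_i < n_{i_0}$, and at least $N$ choices of $i$ satisfying $n_i > n_{i_0}$. Then there exists a convergent series with real coefficients $$f(x) = \sum_{i=0}^\infty c_{n_i} x^{n_i}$$ on $(0,+\infty)$ that is an entrywise positivity preserver on $\mathbb{P}_N((0,+\infty))$, such that $c_{n_i}$ has the sign of $\epsilon_i$ for all $i \geqslant 0$ (negative, zero, or positive according as $\epsilon_i=-1,0,+1$).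
   Context: For $I \subset \mathbb{C}$, $\mathbb{P}_N(I)$ denotes the set of positive semidefinite Hermitian $N\times N$ matrices all of whose entries lie in $I$. For a function $f$ on $I$ and $A=(a_{jk})$ with entries in $I$, $f[A] := (f(a_{jk}))$ is the entrywise application. The function $f$ is an entrywise positivity preserver on $\mathbb{P}_N(I)$ if $f[A]$ is positive semidefinite for every $A \in \mathbb{P}_N(I)$. *)

theory Defs
  imports Complex_Main "Jordan_Normal_Form.Matrix" "Jordan_Normal_Form.Schur_Decomposition"
begin

text \<open>
  The quadratic form is \<open>v\<^sup>* A v\<close>: the product \<open>\<bullet>c\<close> conjugates its second argument, and the order
  on \<^typ>\<open>complex\<close> makes \<open>0 \<le> z\<close> mean that \<open>z\<close> is real and nonnegative.
\<close>

definition positive_semidefinite_mat :: "nat \<Rightarrow> complex mat \<Rightarrow> bool" where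
  "positive_semidefinite_mat N A \<longleftrightarrow>
     A \<in> carrier_mat N N \<and> mat_adjoint A = A \<and>
     (\<forall>v \<in> carrier_vec N. 0 \<le> (A *\<^sub>v v) \<bullet>c v)"

definition psd_mats :: "nat \<Rightarrow> complex set \<Rightarrow> complex mat set" where
  "psd_mats N I = {A. positive_semidefinite_mat N A \<and> elements_mat A \<subseteq> I}"

text \<open>Only the values of \<open>f\<close> on \<open>I\<close> matter here, so a total function stands for a function on \<open>I\<close>.\<close>

definition entrywise_positivity_preserver ::
  "nat \<Rightarrow> complex set \<Rightarrow> (complex \<Rightarrow> complex) \<Rightarrow> bool" where
  "entrywise_positivity_preserver N I f \<longleftrightarrow>
     (\<forall>A \<in> psd_mats N I. positive_semidefinite_mat N (map_mat f A))"

end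

theory Submission
  imports Defs "HOL-Analysis.Convex"
begin

text \<open>
  The series is built from a sum of all monomials with \<open>\<epsilon> i = 1\<close>, with positive and rapidly
  decreasing coefficients, by subtracting tiny multiples of the monomials with \<open>\<epsilon> i = -1\<close>. Each
  monomial \<open>x powr n i\<close> preserves positivity by the theorem of FitzGerald and Horn, so it is
  enough that every negative monomial is dominated, as a quadratic form, by finitely many positive
  ones: if a set \<open>S\<close> of exponents allowed in that theorem has at least \<open>N\<close> elements below \<open>m\<close> and
  at least \<open>N\<close> above it, then for some constant \<open>C\<close> the function \<open>C * (\<Sum>q\<in>S. x powr q) - x powr m\<close>
  preserves positivity (\<open>preserves_psd_domination\<close>). The negative coefficients are then chosen so
  small that together they use up at most the total \<open>\<Sum>i. (1/2) ^ Suc i = 1\<close> of the positive part.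

  The domination is first proved for rank-one matrices \<open>u i * u j\<close>, where it holds because the
  vector \<open>u i powr m\<close> is a combination of the vectors \<open>u i powr q\<close> with coefficients bounded
  independently of \<open>u\<close>. If \<open>k\<close> of the entries of \<open>u\<close> are at most \<open>1\<close> and \<open>l\<close> are larger, one
  interpolates with \<open>k\<close> exponents below \<open>m\<close> and \<open>l\<close> exponents above \<open>m\<close>. After the substitution
  \<open>u = exp t\<close> the bound is a statement about zeros of exponential sums, \<open>coeffs_dominated_exists\<close>,
  and follows from Rolle's theorem by induction on the number of exponents.

  The passage from rank one to all matrices is the extension principle of FitzGerald and Horn
  (\<open>preserves_psd_extension\<close>): subtracting from \<open>A\<close> the rank-one matrix with the same last row and
  column leaves a positive semidefinite matrix of smaller size, and along the segment between the
  two matrices the derivative of \<open>f[-]\<close> is a Hadamard product with \<open>f'[-]\<close>. So a function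
  preserves positivity in size \<open>Suc N\<close> if it does so on rank-one matrices and its derivative does
  so in size \<open>N\<close>. Differentiation lowers the exponents by one and removes at most the exponent
  \<open>0\<close>, which is why admissible exponents stay admissible and enough of them remain.
\<close>

section \<open>Zeros and coefficients of exponential sums\<close>

definition exp_sum :: "real set \<Rightarrow> (real \<Rightarrow> real) \<Rightarrow> real \<Rightarrow> real" where
  "exp_sum E c t = (\<Sum>e\<in>E. c e * exp (e * t))"

text \<open>
  The operator \<open>F \<mapsto> F' - a F\<close> acts on exponential sums by multiplying the coefficient of
  \<open>exp (e * t)\<close> by \<open>e - a\<close>, so it deletes the exponent \<open>a\<close>. As it is the derivative twisted by
  \<open>exp (a * t)\<close>, which has no zeros, Rolle's theorem holds for it.
\<close>

lemma twisted_derivative: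
  "((\<lambda>t. exp (- (a * t)) * exp_sum E c t) has_real_derivative
     exp (- (a * t)) * exp_sum E (\<lambda>e. (e - a) * c e) t) (at t)"
proof -
  have "(\<lambda>t. exp (- (a * t)) * exp_sum E c t) = (\<lambda>t. \<Sum>e\<in>E. c e * exp ((e - a) * t))"
    by (simp add: exp_sum_def sum_distrib_left left_diff_distrib exp_diff exp_minus field_simps)
  moreover have "((\<lambda>t. \<Sum>e\<in>E. c e * exp ((e - a) * t)) has_real_derivative
      (\<Sum>e\<in>E. c e * (exp ((e - a) * t) * (e - a)))) (at t)"
    by (auto intro!: derivative_eq_intros sum.cong)
  moreover have "(\<Sum>e\<in>E. c e * (exp ((e - a) * t) * (e - a)))
      = exp (- (a * t)) * exp_sum E (\<lambda>e. (e - a) * c e) t"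
    by (simp add: exp_sum_def sum_distrib_left left_diff_distrib exp_diff exp_minus field_simps)
  ultimately show ?thesis by simp
qed

lemma twisted_mean_value:
  assumes "r < s"
  obtains x where "r < x" "x < s"
    "exp (- (a * s)) * exp_sum E c s - exp (- (a * r)) * exp_sum E c r
      = (s - r) * (exp (- (a * x)) * exp_sum E (\<lambda>e. (e - a) * c e) x)"
  using MVT2[OF assms, of "\<lambda>t. exp (- (a * t)) * exp_sum E c t", OF twisted_derivative] by blast

lemma isCont_exp_sum [simp]: "isCont (exp_sum E c) t"
  unfolding exp_sum_def by (intro continuous_intros)

lemma rolle_exp_sum:
  assumes "r < s" "exp_sum E c r = 0" "exp_sum E c s = 0"
  obtains x where "r < x" "x < s" "exp_sum E (\<lambda>e. (e - a) * c e) x = 0"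
proof -
  obtain x where "r < x" "x < s"
    and x: "exp (- (a * s)) * exp_sum E c s - exp (- (a * r)) * exp_sum E c r
      = (s - r) * (exp (- (a * x)) * exp_sum E (\<lambda>e. (e - a) * c e) x)"
    using twisted_mean_value[OF assms(1)] by blast
  with assms show ?thesis by (intro that[of x]) auto
qed

lemma rolle_exp_sum_many:
  assumes "finite Z" "Z \<noteq> {}" "\<And>z. z \<in> Z \<Longrightarrow> exp_sum E c z = 0"
  shows "\<exists>Z'. finite Z' \<and> card Z = Suc (card Z') \<and> Z' \<subseteq> {Min Z<..<Max Z} \<and>
           (\<forall>z\<in>Z'. exp_sum E (\<lambda>e. (e - a) * c e) z = 0)"
  using assms
proof (induction Z rule: finite_linorder_max_induct)
  case empty
  then show ?case by simp
next
  case (insert b A)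
  show ?case
  proof (cases "A = {}")
    case True
    then show ?thesis by (intro exI[of _ "{}"]) auto
  next
    case False
    then obtain Z' where Z': "finite Z'" "card A = Suc (card Z')" "Z' \<subseteq> {Min A<..<Max A}"
      "\<forall>z\<in>Z'. exp_sum E (\<lambda>e. (e - a) * c e) z = 0"
      using insert by auto
    have "Max A < b" "exp_sum E c (Max A) = 0" "exp_sum E c b = 0"
      using False insert by auto
    then obtain x where x: "Max A < x" "x < b" "exp_sum E (\<lambda>e. (e - a) * c e) x = 0"
      by (rule rolle_exp_sum)
    have "Min A \<le> Max A" using False insert by simp
    have m: "Min (insert b A) = Min A" "Max (insert b A) = b"
      using False insert.hyps(1) \<open>Max A < b\<close> \<open>Min A \<le> Max A\<close> by simp_all
    show ?thesis
      unfolding m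
    proof (intro exI[of _ "insert x Z'"] conjI)
      have "x \<notin> Z'" "b \<notin> A" using x(1) Z'(3) insert.hyps by auto
      then show "card (insert b A) = Suc (card (insert x Z'))"
        using Z'(1,2) insert.hyps by simp
      show "insert x Z' \<subseteq> {Min A<..<b}"
        using x Z'(3) \<open>Min A \<le> Max A\<close> \<open>Max A < b\<close> by force
    qed (use x Z' in auto)
  qed
qed

text \<open>
  Between a zero on the left of \<open>0\<close> and a zero on its right, Rolle's theorem provides zeros of
  both \<open>F' - a F\<close> and \<open>F' - b F\<close>, but does not tell on which side of \<open>0\<close> they lie. At least one of
  them lies on the useful side: where \<open>F\<close> is positive, \<open>F' - b F\<close> is smaller than \<open>F' - a F\<close>. If
  the latter is nonnegative at \<open>0\<close>, it must still change sign before \<open>F\<close> returns to zero on the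
  right. Otherwise \<open>F' - b F\<close> is negative at \<open>0\<close>, and has changed sign since \<open>F\<close> left its zero on
  the left.
\<close>

lemma gap_zero_pos:
  assumes "a < b" "s < 0" "0 < r" "exp_sum E c s = 0" "exp_sum E c r = 0" "0 < exp_sum E c 0"
  shows "(\<exists>x\<ge>0. s < x \<and> x < r \<and> exp_sum E (\<lambda>e. (e - a) * c e) x = 0) \<or>
         (\<exists>x\<le>0. s < x \<and> x < r \<and> exp_sum E (\<lambda>e. (e - b) * c e) x = 0)"
proof (cases "exp_sum E (\<lambda>e. (e - a) * c e) 0 \<ge> 0")
  case True
  obtain x where x: "0 < x" "x < r" "exp (- (a * r)) * exp_sum E c r - exp (- (a * 0)) * exp_sum E c 0
      = (r - 0) * (exp (- (a * x)) * exp_sum E (\<lambda>e. (e - a) * c e) x)"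
    using twisted_mean_value[OF assms(3), of a] by blast
  then have "r * (exp (- (a * x)) * exp_sum E (\<lambda>e. (e - a) * c e) x) < 0"
    using assms by simp
  then have "exp_sum E (\<lambda>e. (e - a) * c e) x < 0"
    using assms by (simp add: mult_less_0_iff)
  then obtain y where "0 \<le> y" "y \<le> x" "exp_sum E (\<lambda>e. (e - a) * c e) y = 0"
    using IVT2[of "exp_sum E (\<lambda>e. (e - a) * c e)" x 0 0] True x by auto
  then show ?thesis using x(2) assms(2) by (intro disjI1 exI[of _ y] conjI) simp_all
next
  case False
  have "exp_sum E (\<lambda>e. (e - b) * c e) 0 = exp_sum E (\<lambda>e. (e - a) * c e) 0 - (b - a) * exp_sum E c 0"
    by (simp add: exp_sum_def sum_distrib_left flip: sum_subtractf) (simp add: algebra_simps)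
  moreover have "(b - a) * exp_sum E c 0 > 0" using assms by simp
  ultimately have neg: "exp_sum E (\<lambda>e. (e - b) * c e) 0 < 0" using False by linarith
  obtain x where x: "s < x" "x < 0" "exp (- (b * 0)) * exp_sum E c 0 - exp (- (b * s)) * exp_sum E c s
      = (0 - s) * (exp (- (b * x)) * exp_sum E (\<lambda>e. (e - b) * c e) x)"
    using twisted_mean_value[OF assms(2), of b] by blast
  then have "(0 - s) * (exp (- (b * x)) * exp_sum E (\<lambda>e. (e - b) * c e) x) > 0"
    using assms by simp
  then have "exp_sum E (\<lambda>e. (e - b) * c e) x > 0"
    using assms by (simp add: zero_less_mult_iff mult_less_0_iff)
  then obtain y where "x \<le> y" "y \<le> 0" "exp_sum E (\<lambda>e. (e - b) * c e) y = 0"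
    using IVT2[of "exp_sum E (\<lambda>e. (e - b) * c e)" 0 0 x] neg x by auto
  then show ?thesis using x(1) assms(3) by (intro disjI2 exI[of _ y] conjI) simp_all
qed

lemma gap_zero:
  assumes "a < b" "s < r" "s \<le> 0" "0 \<le> r" "exp_sum E c s = 0" "exp_sum E c r = 0"
  shows "(\<exists>x\<ge>0. s < x \<and> x < r \<and> exp_sum E (\<lambda>e. (e - a) * c e) x = 0) \<or>
         (\<exists>x\<le>0. s < x \<and> x < r \<and> exp_sum E (\<lambda>e. (e - b) * c e) x = 0)"
proof (cases "exp_sum E c 0 = 0")
  case True
  show ?thesis
  proof (cases "s < 0")
    case s: True
    obtain x where x: "s < x" "x < 0" "exp_sum E (\<lambda>e. (e - b) * c e) x = 0"
      by (rule rolle_exp_sum[OF s assms(5) True])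
    then have "x \<le> 0" "x < r" using assms(4) by linarith+
    then show ?thesis using x by blast
  next
    case False
    then have "0 < r" using assms(2) by linarith
    obtain x where x: "0 < x" "x < r" "exp_sum E (\<lambda>e. (e - a) * c e) x = 0"
      by (rule rolle_exp_sum[OF \<open>0 < r\<close> True assms(6)])
    then have "x \<ge> 0" "s < x" using assms(3) by linarith+
    then show ?thesis using x by blast
  qed
next
  case False
  then have sr: "s < 0" "0 < r" using assms by (auto simp: order_le_less)
  have minus: "exp_sum E (\<lambda>e. - d e) t = - exp_sum E d t" for d t
    by (simp add: exp_sum_def sum_negf)
  show ?thesis
  proof (cases "exp_sum E c 0 > 0")
    case True
    then show ?thesis using gap_zero_pos assms sr by blast
  next
    case neg: False
    show ?thesis
      using gap_zero_pos[of a b s r E "\<lambda>e. - c e"] assms sr neg False by (simp add: minus)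
  qed
qed

text \<open>
  An exponential sum with \<open>k\<close> exponents below \<open>m\<close> and \<open>l\<close> above \<open>m\<close> that vanishes at \<open>k\<close> points on
  the left of \<open>0\<close> and at \<open>l\<close> points on its right is, up to a factor, the error of interpolating
  \<open>exp (m * t)\<close> by the other exponentials. The bound is uniform in the position of the points, and
  being homogeneous in the coefficients, it includes that \<open>c m = 0\<close> forces the sum to be trivial.
\<close>

definition coeffs_dominated :: "real \<Rightarrow> real set \<Rightarrow> real \<Rightarrow> bool" where
  "coeffs_dominated K E m \<longleftrightarrow>
     (\<forall>c Zl Zu. finite Zl \<and> finite Zu \<and> Zl \<subseteq> {..0} \<and> Zu \<subseteq> {0..} \<and> Zl \<inter> Zu = {} \<and>
        card Zl = card {e\<in>E. e < m} \<and> card Zu = card {e\<in>E. m < e} \<and>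
        (\<forall>z\<in>Zl \<union> Zu. exp_sum E c z = 0)
      \<longrightarrow> (\<forall>e\<in>E. \<bar>c e\<bar> \<le> K * \<bar>c m\<bar>))"

definition elimination_bound :: "real \<Rightarrow> real set \<Rightarrow> real \<Rightarrow> real \<Rightarrow> real" where
  "elimination_bound K E m a = (\<Sum>e\<in>E - {a}. \<bar>K\<bar> * \<bar>m - a\<bar> / \<bar>e - a\<bar>)"

text \<open>
  Applying \<open>F \<mapsto> F' - a F\<close> turns a bound for the exponents \<open>E - {a}\<close> into a bound for all
  coefficients of \<open>F\<close> except \<open>c a\<close>. The missing one is computed from a zero \<open>z\<close> of \<open>F\<close> at which no
  exponential of \<open>E\<close> exceeds \<open>exp (a * z)\<close>. For the least exponent any \<open>z \<le> 0\<close> qualifies, for the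
  greatest exponent any \<open>z \<ge> 0\<close>.
\<close>

lemma eliminate_exponent:
  assumes E: "finite E" "m \<in> E" "a \<in> E" "a \<noteq> m" and dom: "coeffs_dominated K (E - {a}) m"
    and z: "exp_sum E c z = 0" "\<And>e. e \<in> E \<Longrightarrow> (e - a) * z \<le> 0"
    and Z: "finite Zl" "finite Zu" "Zl \<subseteq> {..0}" "Zu \<subseteq> {0..}" "Zl \<inter> Zu = {}"
      "card Zl = card {e\<in>E - {a}. e < m}" "card Zu = card {e\<in>E - {a}. m < e}"
      "\<And>z. z \<in> Zl \<union> Zu \<Longrightarrow> exp_sum E (\<lambda>e. (e - a) * c e) z = 0"
    and e: "e \<in> E"
  shows "\<bar>c e\<bar> \<le> elimination_bound K E m a * \<bar>c m\<bar>"
proof -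
  let ?k = "\<lambda>e. \<bar>K\<bar> * \<bar>m - a\<bar> / \<bar>e - a\<bar>"
  have drop: "exp_sum E (\<lambda>e. (e - a) * c e) t = exp_sum (E - {a}) (\<lambda>e. (e - a) * c e) t" for t
    unfolding exp_sum_def using E by (subst sum.remove[of _ a]) auto
  have dom': "\<bar>(e - a) * c e\<bar> \<le> K * \<bar>(m - a) * c m\<bar>" if "e \<in> E - {a}" for e
    by (rule dom[unfolded coeffs_dominated_def, rule_format, of Zl Zu "\<lambda>e. (e - a) * c e"])
       (use Z that in \<open>simp_all flip: drop\<close>)
  then have bnd: "\<bar>c e\<bar> \<le> ?k e * \<bar>c m\<bar>" if "e \<in> E - {a}" for e
  proof -
    have "\<bar>e - a\<bar> * \<bar>c e\<bar> \<le> K * (\<bar>m - a\<bar> * \<bar>c m\<bar>)"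
      using dom'[OF that] by (simp add: abs_mult)
    also have "\<dots> \<le> \<bar>K\<bar> * (\<bar>m - a\<bar> * \<bar>c m\<bar>)" by (intro mult_right_mono) auto
    finally show ?thesis using that by (simp add: field_simps)
  qed
  have sumbnd: "(\<Sum>e\<in>E - {a}. \<bar>c e\<bar>) \<le> elimination_bound K E m a * \<bar>c m\<bar>"
    unfolding elimination_bound_def sum_distrib_right by (intro sum_mono bnd)
  have "c a * exp (a * z) + (\<Sum>e\<in>E - {a}. c e * exp (e * z)) = 0"
    using z(1) E by (simp add: exp_sum_def sum.remove[of _ a])
  then have ca: "c a * exp (a * z) = - (\<Sum>e\<in>E - {a}. c e * exp (e * z))"
    by linarith
  have shift: "exp (e * z) * exp (- (a * z)) = exp ((e - a) * z)" for e
    unfolding exp_add[symmetric] by (simp add: left_diff_distrib)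
  have "c a = c a * exp (a * z) * exp (- (a * z))"
    using shift[of a] by (simp add: mult.assoc)
  also have "\<dots> = - (\<Sum>e\<in>E - {a}. c e * exp (e * z)) * exp (- (a * z))"
    unfolding ca ..
  also have "\<dots> = - (\<Sum>e\<in>E - {a}. c e * exp ((e - a) * z))"
    by (simp add: sum_distrib_right mult.assoc shift)
  finally have "\<bar>c a\<bar> \<le> (\<Sum>e\<in>E - {a}. \<bar>c e * exp ((e - a) * z)\<bar>)"
    by (simp only: abs_minus_cancel sum_abs)
  also have "\<dots> \<le> (\<Sum>e\<in>E - {a}. \<bar>c e\<bar>)"
    using z(2) by (intro sum_mono) (auto simp: abs_mult intro!: mult_left_le)
  finally have a: "\<bar>c a\<bar> \<le> elimination_bound K E m a * \<bar>c m\<bar>" using sumbnd by simp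
  show ?thesis
  proof (cases "e = a")
    case False
    then have "\<bar>c e\<bar> \<le> (\<Sum>e\<in>E - {a}. \<bar>c e\<bar>)"
      using e E by (intro member_le_sum) auto
    then show ?thesis using sumbnd by simp
  qed (use a in simp)
qed

lemma card_filter_remove:
  assumes "finite E" "a \<in> E"
  shows "P a \<Longrightarrow> card {e\<in>E. P e} = Suc (card {e\<in>E - {a}. P e})"
    and "\<not> P a \<Longrightarrow> {e\<in>E - {a}. P e} = {e\<in>E. P e}"
proof -
  assume "P a"
  then have "{e\<in>E. P e} = insert a {e\<in>E - {a}. P e}" using assms by auto
  then show "card {e\<in>E. P e} = Suc (card {e\<in>E - {a}. P e})" using assms by simp
qed auto

text \<open>
  Induction on the number of exponents, deleting the least exponent \<open>a\<close> or the greatest exponent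
  \<open>b\<close>. Rolle's theorem costs one zero on either side, but returns one in the gap between the two
  sides. The zero counts required for \<open>E - {a}\<close> demand that the zero in the gap be on the right,
  those for \<open>E - {b}\<close> that it be on the left. By \<open>gap_zero\<close> one of the two happens.
\<close>

lemma coeffs_dominated_exists:
  assumes "finite E" "m \<in> E"
  shows "\<exists>K. coeffs_dominated K E m"
  using assms
proof (induction "card E" arbitrary: E)
  case 0
  then show ?case by simp
next
  case (Suc n)
  note fin = Suc.prems(1) and mE = Suc.prems(2)
  define a where "a = Min E"
  define b where "b = Max E"
  have ne: "E \<noteq> {}" using mE by blast
  have ab: "a \<in> E" "b \<in> E" "\<And>e. e \<in> E \<Longrightarrow> a \<le> e" "\<And>e. e \<in> E \<Longrightarrow> e \<le> b"
    using fin ne by (simp_all add: a_def b_def)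
  have dom: "\<exists>K. coeffs_dominated K (E - {d}) m" if d: "d \<in> E" "d \<noteq> m" for d
    using d Suc.hyps(2) fin mE by (intro Suc.hyps(1)) auto
  obtain K1 where K1: "a \<noteq> m \<Longrightarrow> coeffs_dominated K1 (E - {a}) m" using dom ab by blast
  obtain K2 where K2: "b \<noteq> m \<Longrightarrow> coeffs_dominated K2 (E - {b}) m" using dom ab by blast
  define Ka where "Ka = elimination_bound K1 E m a"
  define Kb where "Kb = elimination_bound K2 E m b"
  \<comment> \<open>The bound \<open>1\<close> serves the case \<open>E = {m}\<close>, where nothing can be deleted.\<close>
  define K where "K = max 1 (max Ka Kb)"
  have KK: "Ka * \<bar>c\<bar> \<le> K * \<bar>c\<bar>" "Kb * \<bar>c\<bar> \<le> K * \<bar>c\<bar>" "\<bar>c\<bar> \<le> K * \<bar>c\<bar>" for c :: real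
    using mult_right_mono[of 1 K "\<bar>c\<bar>"] by (auto simp: K_def intro!: mult_right_mono)
  have "coeffs_dominated K E m"
    unfolding coeffs_dominated_def
  proof (intro allI impI ballI, elim conjE)
    fix c Zl Zu e
    assume Z: "finite Zl" "finite Zu" "Zl \<subseteq> {..0}" "Zu \<subseteq> {0..}" "Zl \<inter> Zu = {}"
      and cards: "card Zl = card {e\<in>E. e < m}" "card Zu = card {e\<in>E. m < e}"
      and zero: "\<forall>z\<in>Zl \<union> Zu. exp_sum E c z = 0" and e: "e \<in> E"
    have Zlu: "x < y" if "x \<in> Zl" "y \<in> Zu" for x y
    proof -
      have "x \<noteq> y" using that Z by auto
      moreover have "x \<le> 0" "0 \<le> y" using that Z by auto
      ultimately show ?thesis by linarith
    qed
    have Zl0: "Zl = {} \<longleftrightarrow> \<not> a < m"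
    proof -
      have "Zl = {} \<longleftrightarrow> {e\<in>E. e < m} = {}"
        using card_0_eq[OF Z(1)] card_0_eq[of "{e\<in>E. e < m}"] fin cards(1) by simp
      then show ?thesis using ab by force
    qed
    have Zu0: "Zu = {} \<longleftrightarrow> \<not> m < b"
    proof -
      have "Zu = {} \<longleftrightarrow> {e\<in>E. m < e} = {}"
        using card_0_eq[OF Z(2)] card_0_eq[of "{e\<in>E. m < e}"] fin cards(2) by simp
      then show ?thesis using ab by force
    qed
    have left: "\<bar>c e\<bar> \<le> Ka * \<bar>c m\<bar>"
      if am: "a < m" and Zl': "finite Zl'" "card Zl = Suc (card Zl')" "Zl' \<subseteq> {..0}"
        and Zu': "finite Zu'" "card Zu' = card Zu" "Zu' \<subseteq> {0..}" and disj: "Zl' \<inter> Zu' = {}"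
        and zero': "\<forall>z\<in>Zl' \<union> Zu'. exp_sum E (\<lambda>e. (e - a) * c e) z = 0" for Zl' Zu'
    proof -
      obtain z where z: "z \<in> Zl" using Zl0 am by auto
      have "z \<le> 0" using z Z by auto
      then have "\<forall>e\<in>E. (e - a) * z \<le> 0" using ab by (simp add: mult_nonneg_nonpos)
      moreover have "card Zl' = card {e\<in>E - {a}. e < m}"
        using card_filter_remove(1)[OF fin ab(1), of "\<lambda>e. e < m"] am Zl' cards by simp
      moreover have "card Zu' = card {e\<in>E - {a}. m < e}"
        using card_filter_remove(2)[OF fin ab(1), of "\<lambda>e. m < e"] am Zu' cards by simp
      ultimately show ?thesis using am z zero Zl' Zu' disj zero' e
        unfolding Ka_def by (intro eliminate_exponent[OF fin mE ab(1) _ K1, of c z Zl' Zu']) auto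
    qed
    have right: "\<bar>c e\<bar> \<le> Kb * \<bar>c m\<bar>"
      if am: "m < b" and Zu': "finite Zu'" "card Zu = Suc (card Zu')" "Zu' \<subseteq> {0..}"
        and Zl': "finite Zl'" "card Zl' = card Zl" "Zl' \<subseteq> {..0}" and disj: "Zl' \<inter> Zu' = {}"
        and zero': "\<forall>z\<in>Zl' \<union> Zu'. exp_sum E (\<lambda>e. (e - b) * c e) z = 0" for Zl' Zu'
    proof -
      obtain z where z: "z \<in> Zu" using Zu0 am by auto
      have "z \<ge> 0" using z Z by auto
      then have "\<forall>e\<in>E. (e - b) * z \<le> 0" using ab by (simp add: mult_nonpos_nonneg)
      moreover have "card Zu' = card {e\<in>E - {b}. m < e}"
        using card_filter_remove(1)[OF fin ab(2), of "\<lambda>e. m < e"] am Zu' cards by simp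
      moreover have "card Zl' = card {e\<in>E - {b}. e < m}"
        using card_filter_remove(2)[OF fin ab(2), of "\<lambda>e. e < m"] am Zl' cards by simp
      ultimately show ?thesis using am z zero Zl' Zu' disj zero' e
        unfolding Kb_def by (intro eliminate_exponent[OF fin mE ab(2) _ K2, of c z Zl' Zu']) auto
    qed
    have rl: "\<exists>Z'. finite Z' \<and> card Zl = Suc (card Z') \<and> Z' \<subseteq> {Min Zl<..<Max Zl} \<and> Z' \<subseteq> {..0} \<and>
           (\<forall>z\<in>Z'. exp_sum E (\<lambda>e. (e - d) * c e) z = 0)" if "Zl \<noteq> {}" for d
    proof -
      obtain Z' where *: "finite Z'" "card Zl = Suc (card Z')" "Z' \<subseteq> {Min Zl<..<Max Zl}"
           "(\<forall>z\<in>Z'. exp_sum E (\<lambda>e. (e - d) * c e) z = 0)"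
        using rolle_exp_sum_many[of Zl E c d] Z zero \<open>Zl \<noteq> {}\<close> by auto
      have "Max Zl \<le> 0" using Z that Max_in[of Zl] by blast
      then have "Z' \<subseteq> {..0}" using * by force
      then show ?thesis using * by blast
    qed
    have ru: "\<exists>Z'. finite Z' \<and> card Zu = Suc (card Z') \<and> Z' \<subseteq> {Min Zu<..<Max Zu} \<and> Z' \<subseteq> {0..} \<and>
           (\<forall>z\<in>Z'. exp_sum E (\<lambda>e. (e - d) * c e) z = 0)" if "Zu \<noteq> {}" for d
    proof -
      obtain Z' where *: "finite Z'" "card Zu = Suc (card Z')" "Z' \<subseteq> {Min Zu<..<Max Zu}"
           "(\<forall>z\<in>Z'. exp_sum E (\<lambda>e. (e - d) * c e) z = 0)"
        using rolle_exp_sum_many[of Zu E c d] Z zero \<open>Zu \<noteq> {}\<close> by auto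
      have "Min Zu \<ge> 0" using Z that Min_in[of Zu] by (meson atLeast_iff subsetD)
      then have "Z' \<subseteq> {0..}" using * by force
      then show ?thesis using * by blast
    qed
    consider "Zl = {}" "Zu = {}" | "Zl \<noteq> {}" "Zu = {}" | "Zl = {}" "Zu \<noteq> {}" | "Zl \<noteq> {}" "Zu \<noteq> {}"
      by blast
    then show "\<bar>c e\<bar> \<le> K * \<bar>c m\<bar>"
    proof cases
      case 1
      then have "e = m" using Zl0 Zu0 ab e mE by (meson order.trans order_antisym not_less)
      then show ?thesis using KK by simp
    next
      case 2
      then obtain Z' where "finite Z'" "card Zl = Suc (card Z')" "Z' \<subseteq> {..0}"
          "\<forall>z\<in>Z'. exp_sum E (\<lambda>e. (e - a) * c e) z = 0" using rl[of a] by blast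
      then have "\<bar>c e\<bar> \<le> Ka * \<bar>c m\<bar>" using 2 Zl0 by (intro left[of Z' "{}"]) auto
      then show ?thesis using KK(1) order_trans by blast
    next
      case 3
      then obtain Z' where "finite Z'" "card Zu = Suc (card Z')" "Z' \<subseteq> {0..}"
          "\<forall>z\<in>Z'. exp_sum E (\<lambda>e. (e - b) * c e) z = 0" using ru[of b] by blast
      then have "\<bar>c e\<bar> \<le> Kb * \<bar>c m\<bar>" using 3 Zu0 by (intro right[of Z' "{}"]) auto
      then show ?thesis using KK(2) order_trans by blast
    next
      case 4
      define s where "s = Max Zl"
      define r where "r = Min Zu"
      have sr: "s \<in> Zl" "r \<in> Zu" using 4 Z by (auto simp: s_def r_def)
      have sr': "s < r" "s \<le> 0" "0 \<le> r" "exp_sum E c s = 0" "exp_sum E c r = 0"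
        using sr Zlu Z zero by auto
      have amb: "a < m" "m < b" using 4 Zl0 Zu0 by auto
      from gap_zero[of a b, OF _ sr'] amb consider
          x where "x \<ge> 0" "s < x" "x < r" "exp_sum E (\<lambda>e. (e - a) * c e) x = 0"
        | x where "x \<le> 0" "s < x" "x < r" "exp_sum E (\<lambda>e. (e - b) * c e) x = 0" by auto
      then show ?thesis
      proof cases
        case (1 x)
        obtain Z1 where Z1: "finite Z1" "card Zl = Suc (card Z1)" "Z1 \<subseteq> {Min Zl<..<s}" "Z1 \<subseteq> {..0}"
          "\<forall>z\<in>Z1. exp_sum E (\<lambda>e. (e - a) * c e) z = 0" using rl[of a] 4 unfolding s_def by blast
        obtain Z2 where Z2: "finite Z2" "card Zu = Suc (card Z2)" "Z2 \<subseteq> {r<..<Max Zu}" "Z2 \<subseteq> {0..}"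
          "\<forall>z\<in>Z2. exp_sum E (\<lambda>e. (e - a) * c e) z = 0" using ru[of a] 4 unfolding r_def by blast
        have "x \<notin> Z2" using Z2(3) 1 by force
        moreover have "Z1 \<inter> insert x Z2 = {}" using Z1(3) Z2(3) 1 by force
        ultimately have "\<bar>c e\<bar> \<le> Ka * \<bar>c m\<bar>"
          using Z1 Z2 1 amb by (intro left[of Z1 "insert x Z2"]) auto
        then show ?thesis using KK(1) order_trans by blast
      next
        case (2 x)
        obtain Z1 where Z1: "finite Z1" "card Zl = Suc (card Z1)" "Z1 \<subseteq> {Min Zl<..<s}" "Z1 \<subseteq> {..0}"
          "\<forall>z\<in>Z1. exp_sum E (\<lambda>e. (e - b) * c e) z = 0" using rl[of b] 4 unfolding s_def by blast
        obtain Z2 where Z2: "finite Z2" "card Zu = Suc (card Z2)" "Z2 \<subseteq> {r<..<Max Zu}" "Z2 \<subseteq> {0..}"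
          "\<forall>z\<in>Z2. exp_sum E (\<lambda>e. (e - b) * c e) z = 0" using ru[of b] 4 unfolding r_def by blast
        have "x \<notin> Z1" using Z1(3) 2 by force
        moreover have "insert x Z1 \<inter> Z2 = {}" using Z1(3) Z2(3) 2 by force
        ultimately have "\<bar>c e\<bar> \<le> Kb * \<bar>c m\<bar>"
          using Z1 Z2 2 amb by (intro right[of Z2 "insert x Z1"]) auto
        then show ?thesis using KK(2) order_trans by blast
      qed
    qed
  qed
  then show ?case by blast
qed

section \<open>Interpolation with bounded coefficients\<close>

lemma homogeneous_system_nontrivial:
  fixes M :: "'a \<Rightarrow> 'b \<Rightarrow> 'c::field"
  assumes "finite J" "finite I" "card J < card I"
  shows "\<exists>c. (\<exists>i\<in>I. c i \<noteq> 0) \<and> (\<forall>j\<in>J. (\<Sum>i\<in>I. c i * M i j) = 0)"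
  using assms
proof (induction J arbitrary: I M rule: finite_induct)
  case empty
  then have "I \<noteq> {}" by auto
  then show ?case by (intro exI[of _ "\<lambda>_. 1"]) auto
next
  case (insert j J)
  show ?case
  proof (cases "\<forall>i\<in>I. M i j = 0")
    case True
    have "card J < card I" using insert.hyps insert.prems by simp
    then obtain c where c: "\<exists>i\<in>I. c i \<noteq> 0" "\<And>k. k \<in> J \<Longrightarrow> (\<Sum>i\<in>I. c i * M i k) = 0"
      using insert.IH[OF insert.prems(1), of M] by blast
    moreover have "(\<Sum>i\<in>I. c i * M i j) = 0" using True by simp
    ultimately show ?thesis by blast
  next
    case False
    then obtain p where p: "p \<in> I" "M p j \<noteq> 0" by blast
    define M' where "M' i k = M i k - M i j / M p j * M p k" for i k
    have "card J < card (I - {p})" using insert p by simp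
    then obtain c where c: "\<exists>i\<in>I - {p}. c i \<noteq> 0" "\<And>k. k \<in> J \<Longrightarrow> (\<Sum>i\<in>I - {p}. c i * M' i k) = 0"
      using insert.IH[of "I - {p}" M'] insert.prems by auto
    define d where "d = c(p := - (\<Sum>i\<in>I - {p}. c i * M i j / M p j))"
    have d: "(\<Sum>i\<in>I. d i * M i k) = (\<Sum>i\<in>I - {p}. c i * M' i k)" for k
    proof -
      have "(\<Sum>i\<in>I. d i * M i k) = d p * M p k + (\<Sum>i\<in>I - {p}. d i * M i k)"
        using p insert.prems by (simp add: sum.remove)
      also have "(\<Sum>i\<in>I - {p}. d i * M i k) = (\<Sum>i\<in>I - {p}. c i * M i k)"
        by (intro sum.cong) (auto simp: d_def)
      finally show ?thesis
        by (simp add: d_def M'_def right_diff_distrib sum_subtractf sum_distrib_right mult.assoc)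
    qed
    have "M' i j = 0" for i using p by (simp add: M'_def)
    then have "\<forall>k\<in>insert j J. (\<Sum>i\<in>I. d i * M i k) = 0" using c(2) by (auto simp: d)
    moreover have "\<exists>i\<in>I. d i \<noteq> 0" using c(1) by (auto simp: d_def)
    ultimately show ?thesis by blast
  qed
qed

text \<open>
  A nontrivial exponential sum with one exponent more than there are points can be made to vanish
  at all of them. The exponents are chosen from \<open>S\<close> so that the number below \<open>m\<close> matches the
  points on the left of \<open>0\<close> and the number above \<open>m\<close> the points on the right. Then the coefficient
  bound shows that the coefficient at \<open>m\<close> does not vanish and can be normalised. All points may
  lie on one side, so the choice uses that \<open>S\<close> has \<open>N\<close> exponents on each side of \<open>m\<close>.
\<close>

lemma bounded_interpolation:
  fixes S :: "real set"
  assumes S: "finite S" "N \<le> card {q\<in>S. q < m}" "N \<le> card {q\<in>S. m < q}"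
  obtains B where "B \<ge> 0" "\<And>T. finite T \<Longrightarrow> card T \<le> N \<Longrightarrow>
    \<exists>a. (\<forall>q\<in>S. \<bar>a q\<bar> \<le> B) \<and> (\<forall>t\<in>T. exp (m * t) = exp_sum S a t)"
proof -
  have "\<exists>K. E \<subseteq> S \<longrightarrow> coeffs_dominated K (insert m E) m" for E
    using coeffs_dominated_exists[of "insert m E" m] finite_subset[OF _ S(1)] by auto
  then obtain K where K: "\<And>E. E \<subseteq> S \<Longrightarrow> coeffs_dominated (K E) (insert m E) m" by metis
  \<comment> \<open>There are finitely many choices of exponents, so one constant serves them all.\<close>
  define B where "B = (\<Sum>E\<in>Pow S. \<bar>K E\<bar>)"
  have KB: "K E \<le> B" if "E \<subseteq> S" for E
  proof -
    have "\<bar>K E\<bar> \<le> B" unfolding B_def using S that by (intro member_le_sum) auto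
    then show ?thesis by simp
  qed
  have B0: "B \<ge> 0" unfolding B_def by (intro sum_nonneg) auto
  show ?thesis
  proof (rule that[OF B0])
    fix T :: "real set" assume T: "finite T" "card T \<le> N"
    define Tl where "Tl = {t\<in>T. t \<le> 0}"
    define Tu where "Tu = {t\<in>T. \<not> t \<le> 0}"
    have TT: "T = Tl \<union> Tu" "Tl \<inter> Tu = {}" "finite Tl" "finite Tu" using T by (auto simp: Tl_def Tu_def)
    have cT: "card T = card Tl + card Tu"
      unfolding TT(1) by (rule card_Un_disjoint[OF TT(3,4,2)])
    have leTl: "card Tl \<le> card {q\<in>S. q < m}" and leTu: "card Tu \<le> card {q\<in>S. m < q}"
      using cT T(2) S(2,3) by linarith+
    obtain L where L: "L \<subseteq> {q\<in>S. q < m}" "card L = card Tl"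
      by (rule obtain_subset_with_card_n[OF leTl]) blast
    obtain U where U: "U \<subseteq> {q\<in>S. m < q}" "card U = card Tu"
      by (rule obtain_subset_with_card_n[OF leTu]) blast
    define E where "E = insert m (L \<union> U)"
    have LU: "\<And>q. q \<in> L \<Longrightarrow> q \<in> S \<and> q < m" "\<And>q. q \<in> U \<Longrightarrow> q \<in> S \<and> m < q" using L U by auto
    have fin: "finite L" "finite U" "finite E" using L U S by (auto simp: E_def intro: finite_subset[OF _ S(1)])
    have "card E = Suc (card T)"
    proof -
      have "L \<inter> U = {}" "m \<notin> L \<union> U" using LU by force+
      then show ?thesis using fin L U cT by (simp add: E_def card_Un_disjoint)
    qed
    then obtain c where c: "\<exists>e\<in>E. c e \<noteq> 0" "\<And>t. t \<in> T \<Longrightarrow> exp_sum E c t = 0"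
      using homogeneous_system_nontrivial[OF T(1) fin(3), of "\<lambda>e t. exp (e * t)"]
      unfolding exp_sum_def by auto
    have EL: "{e\<in>E. e < m} = L" "{e\<in>E. m < e} = U" using LU by (force simp: E_def)+
    have cd: "coeffs_dominated (K (L \<union> U)) E m"
      unfolding E_def using L U by (intro K) auto
    have dom: "\<bar>c e\<bar> \<le> K (L \<union> U) * \<bar>c m\<bar>" if "e \<in> E" for e
      by (rule cd[unfolded coeffs_dominated_def, rule_format, of Tl Tu])
         (use TT L U c that in \<open>auto simp: EL\<close>, auto simp: Tl_def Tu_def)
    have cm: "c m \<noteq> 0" using c(1) dom by fastforce
    define a where "a q = (if q \<in> L \<union> U then - c q / c m else 0)" for q
    have "\<bar>a q\<bar> \<le> B" for q
    proof (cases "q \<in> L \<union> U")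
      case True
      then have "\<bar>c q\<bar> \<le> K (L \<union> U) * \<bar>c m\<bar>" by (intro dom) (auto simp: E_def)
      also have "\<dots> \<le> B * \<bar>c m\<bar>" using L U by (intro mult_right_mono KB) auto
      finally show ?thesis using True cm by (simp add: a_def field_simps)
    qed (simp add: a_def B0)
    moreover have "exp (m * t) = exp_sum S a t" if "t \<in> T" for t
    proof -
      have "0 = exp_sum E c t" using c that by simp
      also have "\<dots> = c m * exp (m * t) + (\<Sum>e\<in>L \<union> U. c e * exp (e * t))"
        unfolding exp_sum_def E_def using fin L U by (subst sum.insert) auto
      finally have "exp (m * t) = (\<Sum>e\<in>L \<union> U. - (c e * exp (e * t))) / c m"
        using cm by (simp add: field_simps sum_negf)
      also have "\<dots> = (\<Sum>e\<in>L \<union> U. a e * exp (e * t))"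
        unfolding sum_divide_distrib by (intro sum.cong) (auto simp: a_def)
      also have "\<dots> = exp_sum S a t"
        unfolding exp_sum_def using S L U by (intro sum.mono_neutral_left) (auto simp: a_def)
      finally show ?thesis .
    qed
    ultimately show "\<exists>a. (\<forall>q\<in>S. \<bar>a q\<bar> \<le> B) \<and> (\<forall>t\<in>T. exp (m * t) = exp_sum S a t)" by blast
  qed
qed

text \<open>
  The quadratic form of the rank-one matrix \<open>u i powr q * u j powr q\<close> at \<open>v\<close> is the square of
  \<open>\<Sum>i<N. v i * u i powr q\<close>. Interpolation at the points \<open>ln (u i)\<close> expresses the number for \<open>m\<close> by
  those for \<open>q \<in> S\<close>, with coefficients bounded independently of \<open>u\<close>.
\<close>

lemma rank_one_domination:
  fixes S :: "real set"
  assumes S: "finite S" "N \<le> card {q\<in>S. q < m}" "N \<le> card {q\<in>S. m < q}"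
  shows "\<exists>C\<ge>0. \<forall>u v. (\<forall>i<N. 0 < u i) \<longrightarrow>
    (\<Sum>i<N. v i * u i powr m)\<^sup>2 \<le> C * (\<Sum>q\<in>S. (\<Sum>i<N. v i * u i powr q)\<^sup>2)"
proof -
  obtain B where B: "B \<ge> 0" "\<And>T. finite T \<Longrightarrow> card T \<le> N \<Longrightarrow>
    \<exists>a. (\<forall>q\<in>S. \<bar>a q\<bar> \<le> B) \<and> (\<forall>t\<in>T. exp (m * t) = exp_sum S a t)"
    using bounded_interpolation[OF S] by metis
  show ?thesis
  proof (intro exI[of _ "B\<^sup>2 * real (card S)"] conjI allI impI)
    fix u v :: "nat \<Rightarrow> real" assume u: "\<forall>i<N. 0 < u i"
    define T where "T = (\<lambda>i. ln (u i)) ` {..<N}"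
    define s where "s q = (\<Sum>i<N. v i * u i powr q)" for q
    have "finite T" "card T \<le> N"
      using card_image_le[of "{..<N}" "\<lambda>i. ln (u i)"] by (auto simp: T_def)
    then obtain a where a: "\<And>q. q \<in> S \<Longrightarrow> \<bar>a q\<bar> \<le> B" "\<And>t. t \<in> T \<Longrightarrow> exp (m * t) = exp_sum S a t"
      using B(2) by metis
    have "u i powr m = (\<Sum>q\<in>S. a q * u i powr q)" if "i < N" for i
      using a(2)[of "ln (u i)"] that u by (auto simp: T_def exp_sum_def powr_def)
    then have "s m = (\<Sum>i<N. \<Sum>q\<in>S. a q * (v i * u i powr q))"
      unfolding s_def by (intro sum.cong) (auto simp: sum_distrib_left algebra_simps)
    also have "\<dots> = (\<Sum>q\<in>S. a q * s q)"
      unfolding s_def sum_distrib_left by (rule sum.swap)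
    finally have "(s m)\<^sup>2 = (\<Sum>q\<in>S. a q * s q)\<^sup>2" by simp
    also have "\<dots> \<le> (\<Sum>q\<in>S. (a q * s q)\<^sup>2) * real (card S)"
      by (rule sum_squared_le_sum_of_squares)
    also have "\<dots> \<le> (\<Sum>q\<in>S. B\<^sup>2 * (s q)\<^sup>2) * real (card S)"
    proof (intro mult_right_mono sum_mono)
      fix q assume "q \<in> S"
      then have "(a q)\<^sup>2 \<le> B\<^sup>2" using a(1) B(1) by (metis abs_le_square_iff abs_of_nonneg)
      then show "(a q * s q)\<^sup>2 \<le> B\<^sup>2 * (s q)\<^sup>2" by (simp add: power_mult_distrib mult_right_mono)
    qed simp
    finally show "(s m)\<^sup>2 \<le> B\<^sup>2 * real (card S) * (\<Sum>q\<in>S. (s q)\<^sup>2)"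
      by (simp add: sum_distrib_left mult_ac)
  qed simp
qed

section \<open>Positive semidefinite matrices and the extension principle\<close>

text \<open>
  Matrices are real functions of two indices, of which only the part below \<open>N\<close> counts. Passing to
  the leading submatrix then only changes \<open>N\<close>, which suits induction on the size.
\<close>

definition qform :: "nat \<Rightarrow> (nat \<Rightarrow> nat \<Rightarrow> real) \<Rightarrow> (nat \<Rightarrow> real) \<Rightarrow> real" where
  "qform N A v = (\<Sum>i<N. \<Sum>j<N. v i * v j * A i j)"

definition psd :: "nat \<Rightarrow> (nat \<Rightarrow> nat \<Rightarrow> real) \<Rightarrow> bool" where
  "psd N A \<longleftrightarrow> (\<forall>i<N. \<forall>j<N. A i j = A j i) \<and> (\<forall>v. 0 \<le> qform N A v)"

definition preserves_psd :: "nat \<Rightarrow> (real \<Rightarrow> real) \<Rightarrow> bool" where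
  "preserves_psd N f \<longleftrightarrow>
     (\<forall>A. psd N A \<and> (\<forall>i<N. \<forall>j<N. 0 < A i j) \<longrightarrow> psd N (\<lambda>i j. f (A i j)))"

lemma qform_cong:
  "(\<And>i j. i < N \<Longrightarrow> j < N \<Longrightarrow> A i j = B i j) \<Longrightarrow> (\<And>i. i < N \<Longrightarrow> v i = w i) \<Longrightarrow> qform N A v = qform N B w"
  unfolding qform_def by (intro sum.cong) auto

lemma psd_cong:
  assumes "\<And>i j. i < N \<Longrightarrow> j < N \<Longrightarrow> A i j = B i j"
  shows "psd N A \<longleftrightarrow> psd N B"
  unfolding psd_def using assms qform_cong[of N A B, OF assms] by auto

lemma qform_add: "qform N (\<lambda>i j. A i j + B i j) v = qform N A v + qform N B v"
  by (simp add: qform_def distrib_left sum.distrib)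

lemma qform_scale: "qform N (\<lambda>i j. c * A i j) v = c * qform N A v"
  by (simp add: qform_def sum_distrib_left mult_ac)

lemma qform_sum: "qform N (\<lambda>i j. \<Sum>k\<in>K. A k i j) v = (\<Sum>k\<in>K. qform N (A k) v)"
proof -
  have "qform N (\<lambda>i j. \<Sum>k\<in>K. A k i j) v = (\<Sum>i<N. \<Sum>k\<in>K. \<Sum>j<N. v i * v j * A k i j)"
    unfolding qform_def sum_distrib_left by (intro sum.cong refl sum.swap)
  also have "\<dots> = (\<Sum>k\<in>K. qform N (A k) v)"
    unfolding qform_def by (rule sum.swap)
  finally show ?thesis .
qed

lemma qform_rank_one: "qform N (\<lambda>i j. w i * w j) v = (\<Sum>i<N. v i * w i)\<^sup>2"
  by (simp add: qform_def power2_eq_square sum_product mult_ac)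

lemma psd_rank_one: "psd N (\<lambda>i j. w i * w j)"
  by (simp add: psd_def qform_rank_one mult.commute)

lemma psd_add: "psd N A \<Longrightarrow> psd N B \<Longrightarrow> psd N (\<lambda>i j. A i j + B i j)"
  by (simp add: psd_def qform_add)

lemma psd_scale: "0 \<le> c \<Longrightarrow> psd N A \<Longrightarrow> psd N (\<lambda>i j. c * A i j)"
  by (simp add: psd_def qform_scale)

lemma psd_sum: "(\<And>k. k \<in> K \<Longrightarrow> psd N (A k)) \<Longrightarrow> psd N (\<lambda>i j. \<Sum>k\<in>K. A k i j)"
  by (simp add: psd_def qform_sum sum_nonneg)

lemma qform_Suc:
  assumes "\<And>i. i < N \<Longrightarrow> A N i = A i N"
  shows "qform (Suc N) A v = qform N A v + 2 * v N * (\<Sum>i<N. v i * A i N) + (v N)\<^sup>2 * A N N"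
proof -
  have "(\<Sum>j<N. v N * v j * A N j) = v N * (\<Sum>i<N. v i * A i N)"
    unfolding sum_distrib_left by (intro sum.cong) (auto simp: assms)
  moreover have "(\<Sum>i<N. v i * v N * A i N) = v N * (\<Sum>i<N. v i * A i N)"
    unfolding sum_distrib_left by (intro sum.cong) auto
  ultimately show ?thesis
    by (simp add: qform_def sum.distrib power2_eq_square)
qed

lemma psd_diag_nonneg:
  assumes "psd (Suc N) A" shows "0 \<le> A N N"
proof -
  have "0 \<le> qform (Suc N) A (\<lambda>k. if k = N then 1 else 0)" using assms by (simp add: psd_def)
  also have "\<dots> = A N N"
    using assms by (subst qform_Suc) (auto simp: psd_def qform_def)
  finally show ?thesis .
qed

text \<open>
  A quadratic polynomial that is bounded below and has no quadratic term has no linear term.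
\<close>

lemma psd_zero_diag:
  assumes "psd (Suc N) A" "A N N = 0" "i < N"
  shows "A i N = 0"
proof (rule ccontr)
  assume nz: "A i N \<noteq> 0"
  define x where "x = - (A i i + 1) / (2 * A i N)"
  define v where "v k = (if k = i then 1 else if k = N then x else 0)" for k
  have "0 \<le> qform (Suc N) A v" using assms by (simp add: psd_def)
  also have "\<dots> = qform N A v + 2 * v N * (\<Sum>k<N. v k * A k N) + (v N)\<^sup>2 * A N N"
    using assms(1) by (intro qform_Suc) (auto simp: psd_def)
  also have "(\<Sum>k<N. v k * A k N) = (\<Sum>k<N. if k = i then A i N else 0)"
    by (intro sum.cong) (auto simp: v_def)
  also have "\<dots> = A i N" using assms(3) by simp
  also have "qform N A v = (\<Sum>k<N. if k = i then A i i else 0)"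
  proof -
    have "(\<Sum>j<N. v k * v j * A k j) = (if k = i then A i i else 0)" if "k < N" for k
    proof -
      have "(\<Sum>j<N. v k * v j * A k j) = (\<Sum>j<N. if j = i then (if k = i then A i i else 0) else 0)"
        using that by (intro sum.cong) (auto simp: v_def)
      then show ?thesis using assms(3) by simp
    qed
    then show ?thesis unfolding qform_def by (intro sum.cong) auto
  qed
  also have "\<dots> = A i i" using assms(3) by simp
  also have "v N = x" using assms(3) by (simp add: v_def)
  finally have "0 \<le> A i i + 2 * x * A i N" using assms(2) by simp
  also have "2 * x * A i N = - (A i i + 1)" using nz by (simp add: x_def)
  finally show False by simp
qed

text \<open>
  The complement's form at \<open>v\<close> is the minimum of the form of \<open>A\<close> over all continuations of \<open>v\<close> by
  a last entry. As \<open>x / 0 = 0\<close>, for \<open>A N N = 0\<close> the complement is the leading submatrix itself,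
  which is right because the last column vanishes then.
\<close>

lemma psd_schur_complement:
  assumes A: "psd (Suc N) A"
  shows "psd N (\<lambda>i j. A i j - A i N * A j N / A N N)"
  unfolding psd_def
proof (intro conjI allI impI)
  fix i j assume "i < N" "j < N"
  then show "A i j - A i N * A j N / A N N = A j i - A j N * A i N / A N N"
    using A by (simp add: psd_def)
next
  fix v
  let ?d = "A N N"
  define s where "s = (\<Sum>i<N. v i * A i N)"
  define v' where "v' = v(N := - s / ?d)"
  have "0 \<le> qform (Suc N) A v'" using A by (simp add: psd_def)
  also have "\<dots> = qform N A v' + 2 * v' N * (\<Sum>i<N. v' i * A i N) + (v' N)\<^sup>2 * ?d"
    using A by (intro qform_Suc) (auto simp: psd_def)
  also have "qform N A v' = qform N A v" by (intro qform_cong) (auto simp: v'_def)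
  also have "(\<Sum>i<N. v' i * A i N) = s"
    unfolding s_def by (intro sum.cong) (auto simp: v'_def)
  also have "v' N = - s / ?d" by (simp add: v'_def)
  also have "qform N A v + 2 * (- s / ?d) * s + (- s / ?d)\<^sup>2 * ?d = qform N A v - s\<^sup>2 / ?d"
    by (cases "?d = 0") (simp_all add: field_simps power2_eq_square)
  also have "\<dots> = qform N (\<lambda>i j. A i j + (- 1 / ?d) * (A i N * A j N)) v"
    unfolding qform_add qform_scale qform_rank_one by (simp add: s_def)
  also have "\<dots> = qform N (\<lambda>i j. A i j - A i N * A j N / ?d) v"
    by (intro qform_cong) auto
  finally show "0 \<le> qform N (\<lambda>i j. A i j - A i N * A j N / ?d) v" .
qed

lemma psd_gram:
  assumes "psd N A"
  shows "\<exists>w. \<forall>i<N. \<forall>j<N. A i j = (\<Sum>k<N. w k i * w k j)"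
  using assms
proof (induction N arbitrary: A)
  case 0
  then show ?case by simp
next
  case (Suc N)
  let ?d = "A N N"
  obtain w where w: "\<And>i j. i < N \<Longrightarrow> j < N \<Longrightarrow> A i j - A i N * A j N / ?d = (\<Sum>k<N. w k i * w k j)"
    using Suc.IH[OF psd_schur_complement[OF Suc.prems]] by blast
  define w' where "w' k i = (if k = N then A i N / sqrt ?d else if i = N then 0 else w k i)" for k i
  have d: "0 \<le> ?d" by (rule psd_diag_nonneg[OF Suc.prems])
  have sq: "w' N i * w' N j = A i N * A j N / ?d" for i j
    using d by (simp add: w'_def)
  have last: "A i N = A i N * ?d / ?d" if "i < Suc N" for i
    using psd_zero_diag[OF Suc.prems] that by (cases "?d = 0") (auto simp: less_Suc_eq)
  have sym: "A N j = A j N" if "j < Suc N" for j using Suc.prems that by (simp add: psd_def)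
  have "A i j = (\<Sum>k<Suc N. w' k i * w' k j)" if "i < Suc N" "j < Suc N" for i j
  proof -
    have "(\<Sum>k<Suc N. w' k i * w' k j) = (\<Sum>k<N. w' k i * w' k j) + A i N * A j N / ?d"
      by (simp add: sq)
    also have "\<dots> = A i j"
    proof (cases "i = N \<or> j = N")
      case True
      then have "(\<Sum>k<N. w' k i * w' k j) = 0" by (intro sum.neutral) (auto simp: w'_def)
      then show ?thesis using True last[OF that(1)] last[OF that(2)] sym[OF that(2)] by auto
    next
      case False
      then have "(\<Sum>k<N. w' k i * w' k j) = (\<Sum>k<N. w k i * w k j)"
        by (intro sum.cong) (auto simp: w'_def)
      then show ?thesis using w[of i j] False that by (simp add: less_Suc_eq)
    qed
    finally show ?thesis ..
  qed
  then show ?case by blast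
qed

text \<open>
  A Gram decomposition of \<open>A\<close> writes the product as a sum of congruences of \<open>B\<close> by diagonal
  matrices.
\<close>

lemma schur_product:
  assumes "psd N A" "psd N B"
  shows "psd N (\<lambda>i j. A i j * B i j)"
proof -
  obtain w where w: "\<And>i j. i < N \<Longrightarrow> j < N \<Longrightarrow> A i j = (\<Sum>k<N. w k i * w k j)"
    using psd_gram[OF assms(1)] by blast
  have "psd N (\<lambda>i j. \<Sum>k<N. w k i * w k j * B i j)"
  proof (rule psd_sum)
    fix k
    have "qform N (\<lambda>i j. w k i * w k j * B i j) v = qform N B (\<lambda>i. v i * w k i)" for v
      by (simp add: qform_def mult_ac)
    then show "psd N (\<lambda>i j. w k i * w k j * B i j)"
      using assms(2) by (simp add: psd_def mult_ac)
  qed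
  moreover have "psd N (\<lambda>i j. \<Sum>k<N. w k i * w k j * B i j) \<longleftrightarrow> psd N (\<lambda>i j. A i j * B i j)"
    by (intro psd_cong) (simp add: w sum_distrib_right)
  ultimately show ?thesis by blast
qed

text \<open>
  Let \<open>R\<close> be the rank-one matrix \<open>u i * u j\<close> that has the same last row and column as \<open>A\<close>. The
  segment from \<open>R\<close> to \<open>A\<close> consists of positive semidefinite matrices with positive entries, and
  its direction \<open>B = A - R\<close> is the Schur complement, bordered by zeros. Hence the derivative of
  the form of \<open>f[-]\<close> along the segment only involves the leading submatrix of size \<open>N\<close>, where it
  is the form of the Hadamard product of \<open>f'[-]\<close> and \<open>B\<close>, and thus is nonnegative.
\<close>

lemma preserves_psd_extension:
  assumes deriv: "\<And>x. 0 < x \<Longrightarrow> (f has_real_derivative f' x) (at x)"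
    and f': "preserves_psd N f'"
    and rank_one: "\<And>u. (\<And>i. i < Suc N \<Longrightarrow> 0 < u i) \<Longrightarrow> psd (Suc N) (\<lambda>i j. f (u i * u j))"
  shows "preserves_psd (Suc N) f"
  unfolding preserves_psd_def
proof (intro allI impI, elim conjE)
  fix A assume A: "psd (Suc N) A" and pos: "\<forall>i<Suc N. \<forall>j<Suc N. 0 < A i j"
  let ?d = "A N N"
  have d: "0 < ?d" using pos by simp
  define u where "u i = A i N / sqrt ?d" for i
  define B where "B i j = A i j - u i * u j" for i j
  define M where "M t i j = u i * u j + t * B i j" for t i j
  have u: "0 < u i" if "i < Suc N" for i using pos d that by (simp add: u_def)
  have uu: "u i * u j = A i N * A j N / ?d" for i j using d by (simp add: u_def)
  have symA: "A i j = A j i" if "i < Suc N" "j < Suc N" for i j using A that by (simp add: psd_def)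
  have BN: "B i N = 0" "B N i = 0" if "i < Suc N" for i
    using d that symA[of N i] by (simp_all add: B_def uu)
  have psdB: "psd N B" using psd_schur_complement[OF A] by (simp add: B_def[abs_def] uu)
  have Mpos: "0 < M t i j" if "0 \<le> t" "t \<le> 1" "i < Suc N" "j < Suc N" for t i j
  proof -
    have "M t i j = (1 - t) * (u i * u j) + t * A i j" by (simp add: M_def B_def algebra_simps)
    moreover have "0 < u i * u j" "0 < A i j" using u pos that by auto
    ultimately show ?thesis using that
      by (cases "t = 0") (auto intro: add_nonneg_pos)
  qed
  have M1: "M 1 i j = A i j" and M0: "M 0 i j = u i * u j" for i j by (simp_all add: M_def B_def)
  show "psd (Suc N) (\<lambda>i j. f (A i j))"
    unfolding psd_def
  proof (intro conjI allI impI)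
    fix i j assume "i < Suc N" "j < Suc N"
    then show "f (A i j) = f (A j i)" using symA by simp
  next
    fix v
    have "qform (Suc N) (\<lambda>i j. f (M 0 i j)) v \<le> qform (Suc N) (\<lambda>i j. f (M 1 i j)) v"
    proof (rule DERIV_nonneg_imp_nondecreasing[of 0 1 "\<lambda>t. qform (Suc N) (\<lambda>i j. f (M t i j)) v"])
      fix t :: real assume t: "0 \<le> t" "t \<le> 1"
      have "((\<lambda>t. f (M t i j)) has_real_derivative f' (M t i j) * B i j) (at t)"
        if "i < Suc N" "j < Suc N" for i j
      proof (rule DERIV_chain2[of f])
        show "(f has_real_derivative f' (M t i j)) (at (M t i j))"
          using Mpos t that by (intro deriv) auto
        show "((\<lambda>t. M t i j) has_real_derivative B i j) (at t)"
          unfolding M_def by (auto intro!: derivative_eq_intros)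
      qed
      then have "((\<lambda>t. qform (Suc N) (\<lambda>i j. f (M t i j)) v) has_real_derivative
          qform (Suc N) (\<lambda>i j. f' (M t i j) * B i j) v) (at t)"
        unfolding qform_def by (intro DERIV_sum DERIV_cmult) auto
      moreover have "0 \<le> qform (Suc N) (\<lambda>i j. f' (M t i j) * B i j) v"
      proof -
        have "psd N (M t)"
          unfolding M_def[abs_def] by (intro psd_add psd_rank_one psd_scale psdB t)
        then have "psd N (\<lambda>i j. f' (M t i j))"
          using f' Mpos t by (auto simp: preserves_psd_def)
        then have "psd N (\<lambda>i j. f' (M t i j) * B i j)" by (intro schur_product psdB)
        moreover have "qform (Suc N) (\<lambda>i j. f' (M t i j) * B i j) v = qform N (\<lambda>i j. f' (M t i j) * B i j) v"
          by (subst qform_Suc) (simp_all add: BN)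
        ultimately show ?thesis by (simp add: psd_def)
      qed
      ultimately show "\<exists>y. ((\<lambda>t. qform (Suc N) (\<lambda>i j. f (M t i j)) v) has_real_derivative y) (at t) \<and> 0 \<le> y"
        by blast
    qed simp
    moreover have "0 \<le> qform (Suc N) (\<lambda>i j. f (M 0 i j)) v"
      using rank_one[OF u] by (simp add: psd_def M0)
    ultimately show "0 \<le> qform (Suc N) (\<lambda>i j. f (A i j)) v" by (simp add: M1)
  qed
qed

section \<open>Domination of one power by others\<close>

lemma preserves_psd_0 [simp]: "preserves_psd 0 f"
  by (simp add: preserves_psd_def psd_def qform_def)

lemma preserves_psd_add:
  "preserves_psd N f \<Longrightarrow> preserves_psd N g \<Longrightarrow> preserves_psd N (\<lambda>x. f x + g x)"
  by (simp add: preserves_psd_def psd_add)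

lemma preserves_psd_scale:
  "0 \<le> c \<Longrightarrow> preserves_psd N f \<Longrightarrow> preserves_psd N (\<lambda>x. c * f x)"
  by (simp add: preserves_psd_def psd_scale)

lemma preserves_psd_sum:
  "(\<And>k. k \<in> K \<Longrightarrow> preserves_psd N (f k)) \<Longrightarrow> preserves_psd N (\<lambda>x. \<Sum>k\<in>K. f k x)"
  by (simp add: preserves_psd_def psd_sum)

definition admissible_exponents :: "nat \<Rightarrow> real set" where
  "admissible_exponents N = \<nat> \<union> {real N - 2..}"

lemma admissible_nonneg: "q \<in> admissible_exponents (Suc N) \<Longrightarrow> 0 < N \<Longrightarrow> 0 \<le> q"
  by (auto simp: admissible_exponents_def elim: Nats_cases)

lemma admissible_pred:
  assumes "q \<in> admissible_exponents (Suc N)" "0 < N" "q \<noteq> 0"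
  shows "q - 1 \<in> admissible_exponents N"
  using assms(1) unfolding admissible_exponents_def
proof
  assume "q \<in> \<nat>"
  then obtain k where "q = real k" by (auto elim: Nats_cases)
  then have "q - 1 = real (k - 1)" using assms(3) by (cases k) auto
  then show "q - 1 \<in> \<nat> \<union> {real N - 2..}" by simp
qed auto

lemma
  shows psd_powr_rank_one: "psd N (\<lambda>i j. (u i * u j) powr q)"
    and qform_powr_rank_one: "qform N (\<lambda>i j. (u i * u j) powr q) v = (\<Sum>i<N. v i * u i powr q)\<^sup>2"
  by (simp_all add: powr_mult psd_rank_one qform_rank_one)

text \<open>
  The theorem of FitzGerald and Horn on entrywise powers.
\<close>

lemma preserves_psd_powr:
  "q \<in> admissible_exponents N \<Longrightarrow> preserves_psd N (\<lambda>x. x powr q)"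
proof (induction N arbitrary: q)
  case 0
  show ?case by simp
next
  case (Suc N)
  show ?case
  proof (rule preserves_psd_extension)
    show "((\<lambda>x. x powr q) has_real_derivative q * x powr (q - 1)) (at x)" if "0 < x" for x
      by (rule has_real_derivative_powr[OF that])
    show "preserves_psd N (\<lambda>x. q * x powr (q - 1))"
    proof (cases "N = 0 \<or> q = 0")
      case True
      then show ?thesis by (auto simp: preserves_psd_def psd_def qform_def)
    next
      case False
      then show ?thesis
        using Suc by (intro preserves_psd_scale Suc.IH admissible_pred admissible_nonneg[of q N]) auto
    qed
  qed (rule psd_powr_rank_one)
qed

text \<open>
  The derivative of \<open>C * (\<Sum>q\<in>S. x powr q) - x powr m\<close> is \<open>m\<close> times an expression of the same kind
  in size \<open>N\<close>, with all exponents lowered by one, plus a combination of admissible powers, whose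
  coefficients \<open>C * q - m * C'\<close> are nonnegative for large \<open>C\<close>. The exponent \<open>0\<close> disappears, which
  costs at most one exponent, just as many as the smaller size allows.
\<close>

lemma preserves_psd_domination:
  assumes "finite S" "S \<subseteq> admissible_exponents N"
    and "N \<le> card {q\<in>S. q < m}" "N \<le> card {q\<in>S. m < q}"
  shows "\<exists>C\<ge>0. preserves_psd N (\<lambda>x. C * (\<Sum>q\<in>S. x powr q) - x powr m)"
  using assms
proof (induction N arbitrary: S m)
  case 0
  show ?case by (auto intro: exI[of _ 0])
next
  case (Suc N)
  obtain C1 where C1: "C1 \<ge> 0" "\<And>u v. (\<forall>i<Suc N. 0 < u i) \<Longrightarrow>
    (\<Sum>i<Suc N. v i * u i powr m)\<^sup>2 \<le> C1 * (\<Sum>q\<in>S. (\<Sum>i<Suc N. v i * u i powr q)\<^sup>2)"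
    using rank_one_domination[OF Suc.prems(1,3,4)] by blast
  have "\<exists>C\<ge>C1. preserves_psd N (\<lambda>x. C * (\<Sum>q\<in>S. q * x powr (q - 1)) - m * x powr (m - 1))"
  \<comment> \<open>For \<open>N = 0\<close> the exponents may be negative, and \<open>C * q\<close> then does not grow with \<open>C\<close>; but in
    size \<open>0\<close> there is nothing to preserve.\<close>
  proof (cases "N = 0")
    case True
    then show ?thesis by auto
  next
    case False
    then have N: "0 < N" by simp
    define S0 where "S0 = S - {0}"
    define S' where "S' = (\<lambda>q. q - 1) ` S0"
    have S0: "finite S0" "q \<in> S0 \<Longrightarrow> 0 < q" "q \<in> S0 \<Longrightarrow> q - 1 \<in> admissible_exponents N" for q
      using Suc.prems(1,2) admissible_nonneg[of q N] admissible_pred[of q N] N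
      by (auto simp: S0_def order_le_less)
    have lower: "N \<le> card {q\<in>S'. q < m - 1}"
    proof -
      have "{q\<in>S'. q < m - 1} = (\<lambda>q. q - 1) ` ({q\<in>S. q < m} - {0})"
        by (auto simp: S'_def S0_def)
      then have "card {q\<in>S'. q < m - 1} = card ({q\<in>S. q < m} - {0})"
        by (simp add: card_image)
      moreover have "card {q\<in>S. q < m} - 1 \<le> card ({q\<in>S. q < m} - {0})"
        using diff_card_le_card_Diff[of "{0::real}" "{q\<in>S. q < m}"] by simp
      ultimately show ?thesis using Suc.prems(3) by linarith
    qed
    have upper: "N \<le> card {q\<in>S'. m - 1 < q}"
    proof -
      have "{q\<in>S'. m - 1 < q} = (\<lambda>q. q - 1) ` ({q\<in>S. m < q} - {0})"
        by (auto simp: S'_def S0_def)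
      then have "card {q\<in>S'. m - 1 < q} = card ({q\<in>S. m < q} - {0})"
        by (simp add: card_image)
      moreover have "card {q\<in>S. m < q} - 1 \<le> card ({q\<in>S. m < q} - {0})"
        using diff_card_le_card_Diff[of "{0::real}" "{q\<in>S. m < q}"] by simp
      ultimately show ?thesis using Suc.prems(4) by linarith
    qed
    obtain C' where C': "C' \<ge> 0" "preserves_psd N (\<lambda>x. C' * (\<Sum>q\<in>S'. x powr q) - x powr (m - 1))"
      using Suc.IH[OF _ _ lower upper] S0 by (auto simp: S'_def)
    have "{q\<in>S. q < m} \<noteq> {}" using Suc.prems(3) by force
    then have m: "0 \<le> m" using Suc.prems(2) admissible_nonneg[OF _ N] by force
    define C where "C = C1 + (\<Sum>q\<in>S0. m * C' / q)"
    have CC: "m * C' \<le> C * q" if "q \<in> S0" for q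
    proof -
      have "m * C' / q \<le> (\<Sum>q\<in>S0. m * C' / q)"
        using that S0 m C'(1) by (intro member_le_sum) (auto intro!: divide_nonneg_pos)
      then have "m * C' / q \<le> C" using C1(1) by (simp add: C_def)
      then show ?thesis using S0(2)[OF that] by (simp add: field_simps)
    qed
    have "preserves_psd N (\<lambda>x. m * (C' * (\<Sum>q\<in>S'. x powr q) - x powr (m - 1)) +
        (\<Sum>q\<in>S0. (C * q - m * C') * x powr (q - 1)))"
      using C' m S0 CC
      by (intro preserves_psd_add preserves_psd_scale preserves_psd_sum preserves_psd_powr) auto
    also have "(\<lambda>x. m * (C' * (\<Sum>q\<in>S'. x powr q) - x powr (m - 1)) +
        (\<Sum>q\<in>S0. (C * q - m * C') * x powr (q - 1)))
      = (\<lambda>x. C * (\<Sum>q\<in>S. q * x powr (q - 1)) - m * x powr (m - 1))"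
    proof
      fix x :: real
      have a: "(\<Sum>q\<in>S'. x powr q) = (\<Sum>q\<in>S0. x powr (q - 1))"
        unfolding S'_def by (subst sum.reindex) (auto simp: inj_on_def)
      have b: "(\<Sum>q\<in>S. q * x powr (q - 1)) = (\<Sum>q\<in>S0. q * x powr (q - 1))"
        using Suc.prems(1) by (intro sum.mono_neutral_right) (auto simp: S0_def)
      have "(\<Sum>q\<in>S0. (C * q - m * C') * x powr (q - 1))
        = C * (\<Sum>q\<in>S0. q * x powr (q - 1)) - m * C' * (\<Sum>q\<in>S0. x powr (q - 1))"
        by (simp add: left_diff_distrib sum_subtractf sum_distrib_left mult.assoc)
      then show "m * (C' * (\<Sum>q\<in>S'. x powr q) - x powr (m - 1)) +
        (\<Sum>q\<in>S0. (C * q - m * C') * x powr (q - 1))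
        = C * (\<Sum>q\<in>S. q * x powr (q - 1)) - m * x powr (m - 1)"
        by (simp add: a b right_diff_distrib)
    qed
    finally have "preserves_psd N (\<lambda>x. C * (\<Sum>q\<in>S. q * x powr (q - 1)) - m * x powr (m - 1))" .
    moreover have "C \<ge> C1"
      unfolding C_def using S0 m C'(1) by (simp add: sum_nonneg divide_nonneg_pos)
    ultimately show ?thesis by blast
  qed
  then obtain C where C: "C \<ge> C1"
    "preserves_psd N (\<lambda>x. C * (\<Sum>q\<in>S. q * x powr (q - 1)) - m * x powr (m - 1))" by blast
  have "preserves_psd (Suc N) (\<lambda>x. C * (\<Sum>q\<in>S. x powr q) - x powr m)"
  proof (rule preserves_psd_extension[OF _ C(2)])
    show "((\<lambda>x. C * (\<Sum>q\<in>S. x powr q) - x powr m) has_real_derivative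
        C * (\<Sum>q\<in>S. q * x powr (q - 1)) - m * x powr (m - 1)) (at x)" if "0 < x" for x
      by (intro DERIV_diff DERIV_cmult DERIV_sum has_real_derivative_powr[OF that])
  next
    fix u :: "nat \<Rightarrow> real" assume u: "\<And>i. i < Suc N \<Longrightarrow> 0 < u i"
    let ?f = "\<lambda>x. C * (\<Sum>q\<in>S. x powr q) - x powr m"
    show "psd (Suc N) (\<lambda>i j. ?f (u i * u j))"
      unfolding psd_def
    proof (intro conjI allI impI)
      fix v
      have "qform (Suc N) (\<lambda>i j. ?f (u i * u j)) v
        = qform (Suc N) (\<lambda>i j. C * (\<Sum>q\<in>S. (u i * u j) powr q) + (- 1) * (u i * u j) powr m) v"
        by simp
      also have "\<dots> = C * (\<Sum>q\<in>S. qform (Suc N) (\<lambda>i j. (u i * u j) powr q) v)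
          + (- 1) * qform (Suc N) (\<lambda>i j. (u i * u j) powr m) v"
        unfolding qform_add qform_scale qform_sum ..
      also have "\<dots> = C * (\<Sum>q\<in>S. (\<Sum>i<Suc N. v i * u i powr q)\<^sup>2) - (\<Sum>i<Suc N. v i * u i powr m)\<^sup>2"
        unfolding qform_powr_rank_one by simp
      also have "\<dots> \<ge> 0"
      proof -
        have "C1 * (\<Sum>q\<in>S. (\<Sum>i<Suc N. v i * u i powr q)\<^sup>2) \<le> C * (\<Sum>q\<in>S. (\<Sum>i<Suc N. v i * u i powr q)\<^sup>2)"
          using C(1) by (intro mult_right_mono sum_nonneg) auto
        then show ?thesis using C1(2)[of u v] u by force
      qed
      finally show "0 \<le> qform (Suc N) (\<lambda>i j. ?f (u i * u j)) v" .
    qed (simp add: mult.commute)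
  qed
  then show ?case using C C1 by (meson order_trans)
qed

corollary qform_powr_domination:
  assumes "finite S" "S \<subseteq> admissible_exponents N"
    and "N \<le> card {q\<in>S. q < m}" "N \<le> card {q\<in>S. m < q}"
  obtains C where "C \<ge> 0" "\<And>A v. psd N A \<Longrightarrow> (\<forall>i<N. \<forall>j<N. 0 < A i j) \<Longrightarrow>
    qform N (\<lambda>i j. A i j powr m) v \<le> C * (\<Sum>q\<in>S. qform N (\<lambda>i j. A i j powr q) v)"
proof -
  obtain C where C: "C \<ge> 0" "preserves_psd N (\<lambda>x. C * (\<Sum>q\<in>S. x powr q) - x powr m)"
    using preserves_psd_domination[OF assms] by blast
  show ?thesis
  proof (rule that[OF C(1)])
    fix A v assume "psd N A" "\<forall>i<N. \<forall>j<N. 0 < A i j"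
    then have "0 \<le> qform N (\<lambda>i j. C * (\<Sum>q\<in>S. A i j powr q) - A i j powr m) v"
      using C(2) by (simp add: preserves_psd_def psd_def)
    also have "\<dots> = qform N (\<lambda>i j. C * (\<Sum>q\<in>S. A i j powr q) + (- 1) * A i j powr m) v"
      by simp
    also have "\<dots> = C * (\<Sum>q\<in>S. qform N (\<lambda>i j. A i j powr q) v)
        + (- 1) * qform N (\<lambda>i j. A i j powr m) v"
      unfolding qform_add qform_scale qform_sum ..
    finally show "qform N (\<lambda>i j. A i j powr m) v \<le> C * (\<Sum>q\<in>S. qform N (\<lambda>i j. A i j powr q) v)"
      by simp
  qed
qed

section \<open>Complex matrices with positive entries\<close>

text \<open>
  For a real symmetric matrix the form at a complex vector is the sum of the forms at its real and
  at its imaginary part.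
\<close>

lemma positive_semidefinite_mat_iff_psd:
  assumes M: "M \<in> carrier_mat N N" and B: "\<And>i j. i < N \<Longrightarrow> j < N \<Longrightarrow> M $$ (i, j) = of_real (B i j)"
  shows "positive_semidefinite_mat N M \<longleftrightarrow> psd N B"
proof -
  have adj: "mat_adjoint M = M \<longleftrightarrow> (\<forall>i<N. \<forall>j<N. B i j = B j i)"
  proof -
    have "mat_adjoint M \<in> carrier_mat N N" "\<And>i j. i < N \<Longrightarrow> j < N \<Longrightarrow> mat_adjoint M $$ (i, j) = of_real (B j i)"
      using M B by (auto simp: mat_adjoint_def mat_of_rows_def)
    then have "mat_adjoint M = M \<longleftrightarrow> (\<forall>i<N. \<forall>j<N. complex_of_real (B j i) = of_real (B i j))"
      using M B by (auto simp: mat_eq_iff)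
    then show ?thesis by auto
  qed
  have form: "(M *\<^sub>v v) \<bullet>c v = (\<Sum>i<N. \<Sum>j<N. of_real (B i j) * (v $ j * cnj (v $ i)))"
    if "v \<in> carrier_vec N" for v
  proof -
    have "(M *\<^sub>v v) \<bullet>c v = (\<Sum>i<N. (\<Sum>j<N. of_real (B i j) * v $ j) * cnj (v $ i))"
      using M B that by (auto simp: scalar_prod_def atLeast0LessThan intro!: sum.cong)
    then show ?thesis by (simp add: sum_distrib_right mult.assoc)
  qed
  have re: "Re ((M *\<^sub>v v) \<bullet>c v) = qform N B (\<lambda>i. Re (v $ i)) + qform N B (\<lambda>i. Im (v $ i))"
    if "v \<in> carrier_vec N" for v
    unfolding form[OF that] by (simp add: qform_def algebra_simps sum.distrib)
  have im: "Im ((M *\<^sub>v v) \<bullet>c v) = 0"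
    if "v \<in> carrier_vec N" "\<forall>i<N. \<forall>j<N. B i j = B j i" for v
  proof -
    have "Im ((M *\<^sub>v v) \<bullet>c v) = (\<Sum>i<N. \<Sum>j<N. B i j * (Im (v $ j) * Re (v $ i)))
        - (\<Sum>i<N. \<Sum>j<N. B i j * (Re (v $ j) * Im (v $ i)))"
      unfolding form[OF that(1)] by (simp add: algebra_simps sum_subtractf)
    also have "(\<Sum>i<N. \<Sum>j<N. B i j * (Re (v $ j) * Im (v $ i)))
        = (\<Sum>j<N. \<Sum>i<N. B i j * (Re (v $ j) * Im (v $ i)))"
      by (rule sum.swap)
    also have "\<dots> = (\<Sum>j<N. \<Sum>i<N. B j i * (Im (v $ i) * Re (v $ j)))"
      using that(2) by (intro sum.cong refl) (auto simp: mult.commute)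
    finally show ?thesis by simp
  qed
  show ?thesis
  proof
    assume psdM: "positive_semidefinite_mat N M"
    have "0 \<le> qform N B v" for v
    proof -
      have "0 \<le> (M *\<^sub>v vec N (\<lambda>i. of_real (v i))) \<bullet>c vec N (\<lambda>i. of_real (v i))"
        using psdM by (simp add: positive_semidefinite_mat_def)
      then have "0 \<le> Re ((M *\<^sub>v vec N (\<lambda>i. of_real (v i))) \<bullet>c vec N (\<lambda>i. of_real (v i)))"
        by (simp add: less_eq_complex_def)
      also have "\<dots> = qform N B v"
        by (subst re) (auto simp: qform_def)
      finally show ?thesis .
    qed
    then show "psd N B" using psdM adj by (simp add: psd_def positive_semidefinite_mat_def)
  next
    assume "psd N B"
    then show "positive_semidefinite_mat N M"
      using M adj re im by (auto simp: psd_def positive_semidefinite_mat_def less_eq_complex_def)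
  qed
qed

lemma psd_mats_pos_real:
  assumes "A \<in> psd_mats N (complex_of_real ` {0<..})"
  obtains B where "A \<in> carrier_mat N N" "psd N B" "\<forall>i<N. \<forall>j<N. 0 < B i j"
    "\<And>i j. i < N \<Longrightarrow> j < N \<Longrightarrow> A $$ (i, j) = of_real (B i j)"
proof -
  have A: "positive_semidefinite_mat N A" "elements_mat A \<subseteq> complex_of_real ` {0<..}" "A \<in> carrier_mat N N"
    using assms by (auto simp: psd_mats_def positive_semidefinite_mat_def)
  define B where "B i j = Re (A $$ (i, j))" for i j
  have B: "A $$ (i, j) = of_real (B i j)" "0 < B i j" if "i < N" "j < N" for i j
  proof -
    have "A $$ (i, j) \<in> complex_of_real ` {0<..}"
      using A(2) elements_matI[OF A(3) that refl] by blast
    then show "A $$ (i, j) = of_real (B i j)" "0 < B i j" by (auto simp: B_def)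
  qed
  have "psd N B" using positive_semidefinite_mat_iff_psd[OF A(3) B(1)] A(1) by blast
  then show ?thesis using that A(3) B by blast
qed

section \<open>The series with prescribed signs\<close>

text \<open>
  Since \<open>1 + i\<close> eventually exceeds any given \<open>x\<close>, this weight makes the series converge on the
  whole half-line, whatever the growth of the exponents.
\<close>

definition rapid_weight :: "(nat \<Rightarrow> real) \<Rightarrow> nat \<Rightarrow> real" where
  "rapid_weight n i = (1/2) ^ i / (1 + real i) powr n i"

lemma rapid_weight_pos: "0 < rapid_weight n i"
  by (simp add: rapid_weight_def)

lemma summable_rapid_weight:
  assumes n: "\<And>i. 0 \<le> n i" and b: "\<And>i. \<bar>b i\<bar> \<le> rapid_weight n i" and x: "0 < x"
  shows "summable (\<lambda>i. b i * x powr n i)"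
proof (rule summable_comparison_test_ev)
  show "summable (\<lambda>i. (1/2 :: real) ^ i)" by (simp add: summable_geometric)
  have "norm (b i * x powr n i) \<le> (1/2) ^ i" if "nat \<lceil>x\<rceil> \<le> i" for i
  proof -
    have "x \<le> 1 + real i" using that by linarith
    then have "x powr n i \<le> (1 + real i) powr n i" using x n by (intro powr_mono2) auto
    then have "\<bar>b i\<bar> * x powr n i \<le> rapid_weight n i * (1 + real i) powr n i"
      using b rapid_weight_pos[of n i] by (intro mult_mono) auto
    also have "\<dots> = (1/2) ^ i" by (simp add: rapid_weight_def)
    finally show ?thesis by (simp add: abs_mult)
  qed
  then show "\<forall>\<^sub>F i in sequentially. norm (b i * x powr n i) \<le> (1/2) ^ i"
    by (rule eventually_sequentiallyI)
qed

lemma qform_sums: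
  assumes "\<And>i j. i < N \<Longrightarrow> j < N \<Longrightarrow> (\<lambda>k. A k i j) sums B i j"
  shows "(\<lambda>k. qform N (A k) v) sums qform N B v"
  unfolding qform_def using assms by (intro sums_sum sums_mult) auto

theorem theorem5p8:
  fixes N :: nat and n :: "nat \<Rightarrow> real" and \<epsilon> :: "nat \<Rightarrow> int"
  assumes "N \<ge> 2"
    and "inj n"
    and "range n \<subseteq> \<nat> \<union> {real N - 2..}"
    and "range \<epsilon> \<subseteq> {-1, 0, 1}"
    and "\<And>i0. \<epsilon> i0 = -1 \<Longrightarrow>
           (\<exists>S. finite S \<and> card S \<ge> N \<and> S \<subseteq> {i. \<epsilon> i = 1 \<and> n i < n i0}) \<and>
           (\<exists>S. finite S \<and> card S \<ge> N \<and> S \<subseteq> {i. \<epsilon> i = 1 \<and> n i > n i0})"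
  shows "\<exists>(c :: real \<Rightarrow> real) (f :: complex \<Rightarrow> complex).
           (\<forall>x::real. x > 0 \<longrightarrow>
              (\<lambda>i. complex_of_real (c (n i) * x powr n i)) sums f (complex_of_real x)) \<and>
           entrywise_positivity_preserver N (complex_of_real ` {0<..}) f \<and>
           (\<forall>i. sgn (c (n i)) = of_int (\<epsilon> i))"
proof -
  have adm: "n i \<in> admissible_exponents N" for i
    using assms(3) by (auto simp: admissible_exponents_def)
  have n0: "0 \<le> n i" for i
    using adm[of i] assms(1) by (auto simp: admissible_exponents_def elim: Nats_cases)
  have eps: "\<epsilon> i = -1 \<or> \<epsilon> i = 0 \<or> \<epsilon> i = 1" for i
    using assms(4) by auto
  let ?w = "rapid_weight n"
  define Q where "Q i A v = qform N (\<lambda>j k. A j k powr n i) v" for i A v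
  \<comment> \<open>The positive part of the quadratic form, before the negative monomials are subtracted.\<close>
  define pos_term where "pos_term A v i = (if \<epsilon> i = 1 then ?w i else 0) * Q i A v" for A v i
  have Q0: "0 \<le> Q i A v" if "psd N A" "\<forall>i<N. \<forall>j<N. 0 < A i j" for i A v
    using preserves_psd_powr[OF adm[of i]] that by (simp add: preserves_psd_def psd_def Q_def)
  have Q_sums: "(\<lambda>i. b i * Q i A v) sums qform N (\<lambda>j k. \<Sum>i. b i * A j k powr n i) v"
    if "\<And>i. \<bar>b i\<bar> \<le> ?w i" "\<forall>i<N. \<forall>j<N. 0 < A i j" for b A v
    unfolding Q_def qform_scale[symmetric] using that n0
    by (intro qform_sums summable_sums summable_rapid_weight) auto
  have pos_summable: "summable (pos_term A v)" if "\<forall>i<N. \<forall>j<N. 0 < A i j" for A v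
    unfolding pos_term_def using rapid_weight_pos[of n]
    by (intro sums_summable[OF Q_sums] that) (auto intro: less_imp_le)
  have pos_nonneg: "0 \<le> pos_term A v i" if "psd N A" "\<forall>i<N. \<forall>j<N. 0 < A i j" for A v i
    using Q0[OF that, of i v] rapid_weight_pos[of n i] by (simp add: pos_term_def)
  have "\<exists>D>0. \<epsilon> i = -1 \<longrightarrow> (\<forall>A v. psd N A \<and> (\<forall>i<N. \<forall>j<N. 0 < A i j) \<longrightarrow>
      Q i A v \<le> D * (\<Sum>i. pos_term A v i))" for i
  proof (cases "\<epsilon> i = -1")
    case True
    obtain S1 where S1: "finite S1" "card S1 \<ge> N" "S1 \<subseteq> {k. \<epsilon> k = 1 \<and> n k < n i}"
      using assms(5)[OF True] by blast
    obtain S2 where S2: "finite S2" "card S2 \<ge> N" "S2 \<subseteq> {k. \<epsilon> k = 1 \<and> n k > n i}"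
      using assms(5)[OF True] by blast
    define S where "S = S1 \<union> S2"
    have S: "finite S" "\<And>k. k \<in> S \<Longrightarrow> \<epsilon> k = 1" using S1 S2 by (auto simp: S_def)
    have inj: "inj_on n X" for X using assms(2) by (rule inj_on_subset) simp
    have lower: "N \<le> card {q \<in> n ` S. q < n i}"
    proof -
      have "n ` S1 \<subseteq> {q \<in> n ` S. q < n i}" using S1 by (auto simp: S_def)
      then have "card (n ` S1) \<le> card {q \<in> n ` S. q < n i}" using S by (intro card_mono) auto
      then show ?thesis using S1(2) card_image[OF inj[of S1]] by simp
    qed
    have upper: "N \<le> card {q \<in> n ` S. n i < q}"
    proof -
      have "n ` S2 \<subseteq> {q \<in> n ` S. n i < q}" using S2 by (auto simp: S_def)
      then have "card (n ` S2) \<le> card {q \<in> n ` S. n i < q}" using S by (intro card_mono) auto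
      then show ?thesis using S2(2) card_image[OF inj[of S2]] by simp
    qed
    obtain C where C: "C \<ge> 0" "\<And>A v. psd N A \<Longrightarrow> (\<forall>i<N. \<forall>j<N. 0 < A i j) \<Longrightarrow>
      qform N (\<lambda>j k. A j k powr n i) v \<le> C * (\<Sum>q\<in>n ` S. qform N (\<lambda>j k. A j k powr q) v)"
      using qform_powr_domination[OF _ _ lower upper] S adm by blast
    \<comment> \<open>The domination by \<open>C\<close> times the monomials in \<open>S\<close> is turned into one by the whole positive
      part, so that the choice of \<open>S\<close> no longer matters.\<close>
    define D where "D = 1 + (\<Sum>k\<in>S. C / ?w k)"
    have CD: "C \<le> D * ?w k" if "k \<in> S" for k
    proof -
      have "C / ?w k \<le> (\<Sum>k\<in>S. C / ?w k)"
        using that S C(1) by (intro member_le_sum) (auto intro!: divide_nonneg_pos rapid_weight_pos)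
      then have "C / ?w k \<le> D" by (simp add: D_def)
      then show ?thesis using rapid_weight_pos[of n k] by (simp add: field_simps)
    qed
    have D: "D > 0"
      unfolding D_def using C(1) by (intro add_pos_nonneg sum_nonneg divide_nonneg_pos rapid_weight_pos) auto
    have "Q i A v \<le> D * (\<Sum>i. pos_term A v i)" if A: "psd N A" "\<forall>i<N. \<forall>j<N. 0 < A i j" for A v
    proof -
      have "Q i A v \<le> C * (\<Sum>k\<in>S. Q k A v)"
        using C(2)[OF A, of v] unfolding Q_def sum.reindex[OF inj] by simp
      also have "\<dots> \<le> (\<Sum>k\<in>S. D * pos_term A v k)"
        unfolding sum_distrib_left
      proof (rule sum_mono)
        fix k assume k: "k \<in> S"
        show "C * Q k A v \<le> D * pos_term A v k"
          using mult_right_mono[OF CD[OF k] Q0[OF A, of k v]] S(2)[OF k] by (simp add: pos_term_def mult.assoc)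
      qed
      also have "\<dots> = D * (\<Sum>k\<in>S. pos_term A v k)" by (simp add: sum_distrib_left)
      also have "\<dots> \<le> D * (\<Sum>i. pos_term A v i)"
        using D S pos_nonneg[OF A] pos_summable[OF A(2)] by (intro mult_left_mono sum_le_suminf) auto
      finally show ?thesis .
    qed
    then show ?thesis using D by blast
  qed (auto intro: exI[of _ 1])
  then obtain D where D: "\<And>i. D i > 0" "\<And>i A v. \<epsilon> i = -1 \<Longrightarrow> psd N A \<Longrightarrow> (\<forall>i<N. \<forall>j<N. 0 < A i j) \<Longrightarrow>
      Q i A v \<le> D i * (\<Sum>i. pos_term A v i)"
    by metis
  define b where "b i = (if \<epsilon> i = 1 then ?w i
    else if \<epsilon> i = -1 then - min (?w i) ((1/2) ^ Suc i / D i) else 0)" for i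
  have minpos: "0 < min (?w i) ((1/2) ^ Suc i / D i)" for i using rapid_weight_pos[of n i] D(1)[of i] by simp
  have bw: "\<bar>b i\<bar> \<le> ?w i" for i
    using rapid_weight_pos[of n i] minpos[of i] by (auto simp: b_def)
  define g where "g x = (\<Sum>i. b i * x powr n i)" for x
  define f where "f z = complex_of_real (g (Re z))" for z
  have g_psd: "psd N (\<lambda>i j. g (A i j))" if A: "psd N A" "\<forall>i<N. \<forall>j<N. 0 < A i j" for A
    unfolding psd_def
  proof (intro conjI allI impI)
    fix i j assume "i < N" "j < N"
    then show "g (A i j) = g (A j i)" using A(1) by (simp add: psd_def)
  next
    fix v
    let ?P = "\<Sum>i. pos_term A v i"
    have P0: "0 \<le> ?P" using pos_summable pos_nonneg A by (intro suminf_nonneg) auto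
    have "(\<lambda>i. pos_term A v i - (1/2) ^ Suc i * ?P) sums (?P - 1 * ?P)"
      by (intro sums_diff summable_sums pos_summable sums_mult2 power_half_series A)
    then have low: "(\<lambda>i. pos_term A v i - (1/2) ^ Suc i * ?P) sums 0" by simp
    have up: "(\<lambda>i. b i * Q i A v) sums qform N (\<lambda>i j. g (A i j)) v"
      unfolding g_def by (rule Q_sums[OF bw A(2)])
    \<comment> \<open>Every negative monomial takes at most its share \<open>(1/2) ^ Suc i\<close> of the positive part.\<close>
    have le: "pos_term A v i - (1/2) ^ Suc i * ?P \<le> b i * Q i A v" for i
    proof -
      consider "\<epsilon> i = 1" | "\<epsilon> i = 0" | "\<epsilon> i = -1" using eps by blast
      then show ?thesis
      proof cases
        case 3
        have "min (?w i) ((1/2) ^ Suc i / D i) * Q i A v \<le> (1/2) ^ Suc i / D i * Q i A v"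
          using Q0[OF A] by (intro mult_right_mono) auto
        also have "\<dots> \<le> (1/2) ^ Suc i / D i * (D i * ?P)"
          using D(2)[OF 3 A, of v] D(1)[of i] by (intro mult_left_mono) auto
        also have "\<dots> = (1/2) ^ Suc i * ?P" using D(1)[of i] by simp
        finally show ?thesis using 3 by (simp add: b_def pos_term_def)
      qed (use P0 in \<open>simp_all add: b_def pos_term_def\<close>)
    qed
    show "0 \<le> qform N (\<lambda>i j. g (A i j)) v" by (rule sums_le[OF le low up])
  qed
  have "entrywise_positivity_preserver N (complex_of_real ` {0<..}) f"
    unfolding entrywise_positivity_preserver_def
  proof
    fix A assume "A \<in> psd_mats N (complex_of_real ` {0<..})"
    then obtain B where B: "A \<in> carrier_mat N N" "psd N B" "\<forall>i<N. \<forall>j<N. 0 < B i j"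
      "\<And>i j. i < N \<Longrightarrow> j < N \<Longrightarrow> A $$ (i, j) = of_real (B i j)"
      by (rule psd_mats_pos_real) blast
    have "positive_semidefinite_mat N (map_mat f A) \<longleftrightarrow> psd N (\<lambda>i j. g (B i j))"
      using B by (intro positive_semidefinite_mat_iff_psd) (auto simp: f_def)
    then show "positive_semidefinite_mat N (map_mat f A)" using g_psd B by blast
  qed
  moreover have "(\<lambda>i. complex_of_real (b (the_inv n (n i)) * x powr n i)) sums f (complex_of_real x)"
    if "x > 0" for x
    using summable_sums[OF summable_rapid_weight[OF n0 bw that]] assms(2)
    by (simp add: f_def g_def sums_of_real_iff the_inv_f_f del: of_real_mult)
  moreover have "sgn (b (the_inv n (n i))) = of_int (\<epsilon> i)" for i
    using eps[of i] rapid_weight_pos[of n i] minpos[of i] assms(2) by (auto simp: b_def sgn_if the_inv_f_f)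
  ultimately show ?thesis by (intro exI[of _ "b \<circ> the_inv n"] exI[of _ f]) simp
qed

end
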